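(* Fix an integer $u\geqslant 2$ and a sequence $(s_m)_{m=1}^\infty$ of nonnegative integers such that $s_m\geqslant k$ for all integers $k\geqslant 1$ and $m\geqslant uk+1$. For $n\geqslant 1$, let $\mathcal{B}^{\mathbf s,u}_n$ be the collection of sub-multisets $B$ of the multiset $\{\underbrace{1,\ldots,1}_{s_1},\underbrace{2,\ldots,2}_{s_2},\ldots,\underbrace{n,\ldots,n}_{s_n}\}$ such that $B=\emptyset$ or $\min B\geqslant u|B|+1$. Then $|\mathcal{B}^{\mathbf s,u}_n| = K^{(u)}_n$ for all $n\geqslant 1$.
   Context: Sub-multisets are counted as multisets (copies of the same integer are indistinguishable), and $|B|$ is the size of $B$ counted with multiplicity. The sequence $(K^{(u)}_n)_{n\geqslant 1}$ is defined by $K^{(u)}_1=\cdots=K^{(u)}_u=1$ and $K^{(u)}_n=K^{(u)}_{n-1}+K^{(u)}_{n-u}$ for $n\geqslant u+1$. *)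

theory Defs
  imports "HOL-Library.Multiset"
begin

(* K u n is meant for u >= 1 and n >= 1; the value 0 elsewhere is junk that
   makes the recursion total. *)
fun K :: "nat \<Rightarrow> nat \<Rightarrow> nat" where
  "K u n = (if u = 0 \<or> n = 0 then 0
            else if n \<le> u then 1
            else K u (n - 1) + K u (n - u))"

declare K.simps [simp del]

(* s 0 is never used: the sequence s is indexed from 1. *)
definition ground_mset :: "(nat \<Rightarrow> nat) \<Rightarrow> nat \<Rightarrow> nat multiset" where
  "ground_mset s n = (\<Sum>m\<in>{1..n}. replicate_mset (s m) m)"

definition schreier_msets :: "(nat \<Rightarrow> nat) \<Rightarrow> nat \<Rightarrow> nat \<Rightarrow> nat multiset set" where
  "schreier_msets s u n =
     {B. B \<subseteq># ground_mset s n \<and> (B = {#} \<or> Min (set_mset B) \<ge> u * size B + 1)}"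

end

(* The bounds s m \<ge> k make the multiplicity restrictions vacuous, so the family consists of all
   finite multisets B with elements in {u |B| + 1..n}.  Those avoiding n form the family for n - 1;
   from those containing n, removing one copy of n and shifting the remaining elements down by u
   gives a bijection onto the family for n - u.  This is the recurrence of K. *)
theory Submission
  imports Defs
begin

text \<open>Bounding every element, instead of the minimum, makes the empty multiset a vacuous
  member and avoids \<open>Min\<close> of an empty set.\<close>

definition free_schreier :: "nat \<Rightarrow> nat \<Rightarrow> nat multiset set" where
  "free_schreier u n = {B. \<forall>x\<in>#B. u * size B < x \<and> x \<le> n}"

lemma count_ground_mset:
  "count (ground_mset s n) x = (if 1 \<le> x \<and> x \<le> n then s x else 0)"
  by (simp add: ground_mset_def count_sum)

text \<open>For nonempty \<open>B\<close> in the free family, every element \<open>x\<close> is at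
  least \<open>u * size B + 1\<close>, so the assumption with \<open>k = size B\<close> gives
  \<open>s x \<ge> size B \<ge> count B x\<close>.\<close>

lemma schreier_msets_eq_free_schreier:
  assumes "\<And>k m. k \<ge> 1 \<Longrightarrow> m \<ge> u * k + 1 \<Longrightarrow> s m \<ge> k"
  shows "schreier_msets s u n = free_schreier u n"
proof (intro set_eqI iffI)
  fix B assume "B \<in> schreier_msets s u n"
  then have sub: "B \<subseteq># ground_mset s n"
    and min: "B = {#} \<or> u * size B + 1 \<le> Min (set_mset B)"
    by (auto simp: schreier_msets_def)
  have "u * size B < x \<and> x \<le> n" if "x \<in># B" for x
  proof
    show "u * size B < x"
      using min that Min_le[OF finite_set_mset that] by (metis Suc_eq_plus1 Suc_le_eq empty_iff le_trans set_mset_empty)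
    have "count (ground_mset s n) x \<noteq> 0"
      using sub that by (metis mset_subset_eqD not_in_iff)
    then show "x \<le> n"
      by (simp add: count_ground_mset split: if_splits)
  qed
  then show "B \<in> free_schreier u n"
    by (simp add: free_schreier_def)
next
  fix B assume "B \<in> free_schreier u n"
  then have B: "u * size B < x" "x \<le> n" if "x \<in># B" for x
    using that by (auto simp: free_schreier_def)
  have "count B x \<le> count (ground_mset s n) x" for x
  proof (cases "x \<in># B")
    case True
    then have "1 \<le> size B"
      by (cases B) auto
    then have "size B \<le> s x"
      using B(1)[OF True] by (intro assms) auto
    then show ?thesis
      using B[OF True] count_le_size[of B x] by (simp add: count_ground_mset)
  qed (simp add: not_in_iff)
  moreover have "u * size B + 1 \<le> Min (set_mset B)" if "B \<noteq> {#}"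
    using that B(1) by (simp add: Suc_le_eq)
  ultimately show "B \<in> schreier_msets s u n"
    unfolding schreier_msets_def subseteq_mset_def by blast
qed

text \<open>An element \<open>x\<close> of a nonempty member would give
  \<open>u \<le> u * size B < x \<le> n\<close>.\<close>

lemma free_schreier_trivial:
  assumes "n \<le> u"
  shows "free_schreier u n = {{#}}"
proof (intro subset_antisym subsetI)
  fix B assume B: "B \<in> free_schreier u n"
  show "B \<in> {{#}}"
  proof (cases B)
    case (add x C)
    then have "u * size B < x" "x \<le> n" "size B \<ge> 1"
      using B by (auto simp: free_schreier_def)
    then have "u < n"
      by (metis le_trans less_le_trans linorder_not_le mult.right_neutral mult_le_mono2)
    then show ?thesis
      using assms by simp
  qed simp
qed (simp add: free_schreier_def)

lemma free_schreier_rec: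
  assumes "u < n"
  shows "free_schreier u n =
    free_schreier u (n - 1) \<union> (\<lambda>C. add_mset n (image_mset ((+) u) C)) ` free_schreier u (n - u)"
    (is "_ = _ \<union> ?f ` _")
proof (intro subset_antisym subsetI)
  fix B assume "B \<in> free_schreier u n"
  then have B: "u * size B < x" "x \<le> n" if "x \<in># B" for x
    using that by (auto simp: free_schreier_def)
  show "B \<in> free_schreier u (n - 1) \<union> ?f ` free_schreier u (n - u)"
  proof (cases "n \<in># B")
    case True
    then obtain D where D: "B = add_mset n D"
      by (metis mset_add)
    let ?C = "image_mset (\<lambda>x. x - u) D"
    have bounds: "u + u * size D < x" "x \<le> n" if "x \<in># D" for x
      using B[of x] that by (simp_all add: D)
    \<comment> \<open>Each \<open>x\<close> in \<open>D\<close> exceeds \<open>u\<close>, because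
      \<open>size B = size D + 1\<close>; hence the truncated subtraction in \<open>?C\<close> loses
      nothing.\<close>
    have "image_mset ((+) u) ?C = image_mset id D"
      unfolding multiset.map_comp using bounds by (intro image_mset_cong) force
    then have "B = ?f ?C"
      by (simp add: D)
    moreover have "?C \<in> free_schreier u (n - u)"
      using bounds by (fastforce simp: free_schreier_def)
    ultimately show ?thesis
      by blast
  next
    case False
    then have "x \<le> n - 1" if "x \<in># B" for x
      using B(2)[OF that] that by (cases "x = n") auto
    then show ?thesis
      using B(1) by (simp add: free_schreier_def)
  qed
next
  fix B assume "B \<in> free_schreier u (n - 1) \<union> ?f ` free_schreier u (n - u)"
  then show "B \<in> free_schreier u n"
  proof
    assume "B \<in> free_schreier u (n - 1)"
    then show ?thesis
      by (fastforce simp: free_schreier_def)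
  next
    assume "B \<in> ?f ` free_schreier u (n - u)"
    then obtain C where BC: "B = ?f C" and C: "C \<in> free_schreier u (n - u)"
      by blast
    have bounds: "u * size C < x" "x \<le> n - u" if "x \<in># C" for x
      using C that by (auto simp: free_schreier_def)
    \<comment> \<open>This is the condition on the added element \<open>n\<close> itself. For empty
      \<open>C\<close> it is the assumption \<open>u < n\<close>; otherwise any \<open>x\<close> in
      \<open>C\<close> lies strictly above \<open>u * size C\<close> and at most at
      \<open>n - u\<close>.\<close>
    have "u + u * size C < n"
    proof (cases "C = {#}")
      case False
      then obtain x where "x \<in># C"
        by blast
      then show ?thesis
        using bounds[of x] by linarith
    qed (use assms in simp)
    moreover have "u + x \<le> n" if "x \<in># C" for x
      using bounds(2)[OF that] assms by linarith
    ultimately show ?thesis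
      using bounds(1) by (auto simp: free_schreier_def BC)
  qed
qed

text \<open>Finiteness is carried through the induction because the cardinality of the disjoint
  union requires it. The induction is strong since the recurrence reaches back \<open>u\<close>
  steps.\<close>

lemma free_schreier_card:
  assumes "u \<ge> 1" "n \<ge> 1"
  shows "finite (free_schreier u n) \<and> card (free_schreier u n) = K u n"
  using assms(2)
proof (induction n rule: less_induct)
  case (less n)
  show ?case
  proof (cases "n \<le> u")
    case True
    then show ?thesis
      using less.prems assms(1) by (simp add: free_schreier_trivial K.simps[of u n])
  next
    case False
    let ?f = "\<lambda>C. add_mset n (image_mset ((+) u) C)"
    \<comment> \<open>From \<open>1 \<le> u < n\<close>, both \<open>n - 1\<close> and
      \<open>n - u\<close> are positive and smaller than \<open>n\<close>.\<close>
    have IH: "finite (free_schreier u m)" "card (free_schreier u m) = K u m"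
      if "m = n - 1 \<or> m = n - u" for m
      using less.IH[of m] that False assms(1) by auto
    have inj: "inj_on ?f (free_schreier u (n - u))"
      \<comment> \<open>The left inverse removes one copy of \<open>n\<close> and shifts back by
        \<open>u\<close>.\<close>
      by (intro inj_on_inverseI[where g = "\<lambda>B. image_mset (\<lambda>x. x - u) (B - {#n#})"])
        (simp add: multiset.map_comp comp_def)
    \<comment> \<open>Disjointness: \<open>n\<close> exceeds the bound \<open>n - 1\<close>, whereas
      every value of \<open>?f\<close> contains \<open>n\<close>.\<close>
    have "n \<notin># B" if "B \<in> free_schreier u (n - 1)" for B
      using that less.prems by (fastforce simp: free_schreier_def)
    then have "free_schreier u (n - 1) \<inter> ?f ` free_schreier u (n - u) = {}"
      by fastforce
    moreover have "free_schreier u n = free_schreier u (n - 1) \<union> ?f ` free_schreier u (n - u)"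
      using False by (intro free_schreier_rec) simp
    moreover have "K u n = K u (n - 1) + K u (n - u)"
      using False assms(1) by (simp add: K.simps[of u n])
    ultimately show ?thesis
      using IH by (simp add: card_Un_disjoint card_image[OF inj])
  qed
qed

theorem theorem2:
  fixes u :: nat and s :: "nat \<Rightarrow> nat"
  assumes "u \<ge> 2"
    and "\<And>k m. k \<ge> 1 \<Longrightarrow> m \<ge> u * k + 1 \<Longrightarrow> s m \<ge> k"
  shows "\<forall>n\<ge>1. card (schreier_msets s u n) = K u n"
  using assms free_schreier_card[of u] by (simp add: schreier_msets_eq_free_schreier[of u s])

end
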